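(* Let $\rho,t>0$ and let $M$ be an $n\times n$ symmetric positive definite matrix with $M-\rho\mathcal A^T\mathcal A\succeq0$. Then the primal algorithmic map $\mathrm{Prim}_t$ defined by $$z^+=\mathrm{Prim}_t(z,\lambda)\equiv\operatorname{argmin}_{\xi\in\mathbb R^n}\left\{\Psi(\xi)+\langle\lambda,\mathcal A\xi-b\rangle+\rho_t\langle\mathcal A z-b,\mathcal A\xi\rangle+\frac{\tau_t}{2}\|\xi-z\|_M^2\right\}$$ is nice with $\delta=1$ and $P=Q=M-\rho\mathcal A^T\mathcal A$.
   Context: **Problem.** Let $\Psi:\mathbb R^n\to(-\infty,+\infty]$ be proper, lower semicontinuous and $\sigma$-strongly convex with $\sigma\ge 0$ ($\sigma=0$ means merely convex), $\mathcal A:\mathbb R^n\to\mathbb R^m$ linear, $b\in\mathbb R^m$. Problem (P) is $\min\{\Psi(x):\mathcal A x=b,\ x\in\mathbb R^n\}$, with feasible set $\mathcal F=\{x\in\mathbb R^n:\mathcal A x=b\}$. The Lagrangian is $\mathcal L(x,y)=\Psi(x)+\langle y,\mathcal A x-b\rangle$ and, for $\rho\geq 0$, the augmented Lagrangian is $\mathcal L_\rho(x,y)=\mathcal L(x,y)+\frac{\rho}{2}\|\mathcal A x-b\|^2$. Standing assumption: $\mathcal L$ has a saddle point. **Notation.** $\mathbb S_+^n$ is the set of $n\times n$ symmetric positive semidefinite matrices; for $P\in\mathbb S_+^n$, $\|u\|_P=\sqrt{\langle u,Pu\rangle}$ and $\Delta_P(u,v,w)=\frac12(\|u-v\|_P^2-\|u-w\|_P^2)$.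 **Nice primal algorithmic map.** Given $\rho,t>0$, let $\rho_t=\rho,\tau_t=1$ if $\sigma=0$, and $\rho_t=\rho t,\tau_t=t$ if $\sigma>0$. A (possibly set-valued) map $\mathrm{Prim}_t$ on $\mathbb R^n\times\mathbb R^m$ with values in $\mathbb R^n$ is nice with $\delta\in(0,1]$ and $P,Q\in\mathbb S_+^n$ if for all $(z,\lambda)$, all $z^+\in\mathrm{Prim}_t(z,\lambda)$ and all $\xi\in\mathcal F$, $$\mathcal L_{\rho_t}(z^+,\lambda)-\mathcal L_{\rho_t}(\xi,\lambda)\le\tau_t\Delta_P(\xi,z,z^+)-\frac{\tau_t}{2}\|z^+-z\|_Q^2-\frac{\sigma}{2}\|\xi-z^+\|^2-\frac{\delta\rho_t}{2}\|\mathcal A z^+-b\|^2.$$ *)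

theory Defs
  imports "HOL-Analysis.Analysis"
begin

definition proper_fun :: "('a \<Rightarrow> ereal) \<Rightarrow> bool" where
  "proper_fun f \<longleftrightarrow> (\<forall>x. f x \<noteq> -\<infinity>) \<and> (\<exists>x. f x \<noteq> \<infinity>)"

definition lower_semicontinuous :: "('a::topological_space \<Rightarrow> ereal) \<Rightarrow> bool" where
  "lower_semicontinuous f \<longleftrightarrow> (\<forall>x. f x \<le> Liminf (at x) f)"

text \<open>The sum on the right is unambiguous in \<^typ>\<open>ereal\<close> only for functions that never take the
  value minus infinity; the definition is meant to be used together with \<open>proper_fun\<close>.\<close>
definition strongly_convex :: "real \<Rightarrow> ('a::real_normed_vector \<Rightarrow> ereal) \<Rightarrow> bool" where
  "strongly_convex \<sigma> f \<longleftrightarrow>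
     (\<forall>x y. \<forall>\<theta>\<in>{0<..<1}.
        f (\<theta> *\<^sub>R x + (1 - \<theta>) *\<^sub>R y)
          \<le> ereal \<theta> * f x + ereal (1 - \<theta>) * f y
             - ereal (\<sigma> / 2 * \<theta> * (1 - \<theta>) * (norm (x - y))\<^sup>2))"

definition psd :: "real^'n^'n \<Rightarrow> bool" where
  "psd P \<longleftrightarrow> transpose P = P \<and> (\<forall>u. 0 \<le> u \<bullet> (P *v u))"

definition pos_definite :: "real^'n^'n \<Rightarrow> bool" where
  "pos_definite P \<longleftrightarrow> transpose P = P \<and> (\<forall>u. u \<noteq> 0 \<longrightarrow> 0 < u \<bullet> (P *v u))"

definition mnorm :: "real^'n^'n \<Rightarrow> real^'n \<Rightarrow> real" where
  "mnorm P u = sqrt (u \<bullet> (P *v u))"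

definition mDelta :: "real^'n^'n \<Rightarrow> real^'n \<Rightarrow> real^'n \<Rightarrow> real^'n \<Rightarrow> real" where
  "mDelta P u v w = 1 / 2 * ((mnorm P (u - v))\<^sup>2 - (mnorm P (u - w))\<^sup>2)"

definition feasible :: "(real^'n \<Rightarrow> real^'m) \<Rightarrow> real^'m \<Rightarrow> (real^'n) set" where
  "feasible A b = {x. A x = b}"

definition lagr ::
  "(real^'n \<Rightarrow> ereal) \<Rightarrow> (real^'n \<Rightarrow> real^'m) \<Rightarrow> real^'m \<Rightarrow> real^'n \<Rightarrow> real^'m \<Rightarrow> ereal" where
  "lagr \<Psi> A b x y = \<Psi> x + ereal (y \<bullet> (A x - b))"

definition aug_lagr ::
  "(real^'n \<Rightarrow> ereal) \<Rightarrow> (real^'n \<Rightarrow> real^'m) \<Rightarrow> real^'m \<Rightarrow> real \<Rightarrow> real^'n \<Rightarrow> real^'m \<Rightarrow> ereal" where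
  "aug_lagr \<Psi> A b \<rho> x y = lagr \<Psi> A b x y + ereal (\<rho> / 2 * (norm (A x - b))\<^sup>2)"

definition saddle_point :: "('a \<Rightarrow> 'b \<Rightarrow> ereal) \<Rightarrow> 'a \<Rightarrow> 'b \<Rightarrow> bool" where
  "saddle_point L xs ys \<longleftrightarrow> (\<forall>x y. L xs y \<le> L xs ys \<and> L xs ys \<le> L x ys)"

definition rho_t :: "real \<Rightarrow> real \<Rightarrow> real \<Rightarrow> real" where
  "rho_t \<sigma> \<rho> t = (if \<sigma> = 0 then \<rho> else \<rho> * t)"

definition tau_t :: "real \<Rightarrow> real \<Rightarrow> real" where
  "tau_t \<sigma> t = (if \<sigma> = 0 then 1 else t)"

text \<open>With the conventions of \<^typ>\<open>ereal\<close>, the difference below is plus infinity when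
  \<open>\<Psi> z' = \<infinity>\<close> (so the inequality then fails), and minus infinity when only \<open>\<Psi> \<xi> = \<infinity>\<close>.\<close>
definition nice_primal_map ::
  "(real^'n \<Rightarrow> ereal) \<Rightarrow> (real^'n \<Rightarrow> real^'m) \<Rightarrow> real^'m \<Rightarrow> real \<Rightarrow> real \<Rightarrow> real \<Rightarrow>
   (real^'n \<Rightarrow> real^'m \<Rightarrow> (real^'n) set) \<Rightarrow> real \<Rightarrow> real^'n^'n \<Rightarrow> real^'n^'n \<Rightarrow> bool" where
  "nice_primal_map \<Psi> A b \<sigma> \<rho> t Prim \<delta> P Q \<longleftrightarrow>
     \<delta> \<in> {0<..1} \<and> psd P \<and> psd Q \<and>
     (\<forall>z y. \<forall>z'\<in>Prim z y. \<forall>\<xi>\<in>feasible A b.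
        aug_lagr \<Psi> A b (rho_t \<sigma> \<rho> t) z' y - aug_lagr \<Psi> A b (rho_t \<sigma> \<rho> t) \<xi> y
          \<le> ereal (tau_t \<sigma> t * mDelta P \<xi> z z'
                   - tau_t \<sigma> t / 2 * (mnorm Q (z' - z))\<^sup>2
                   - \<sigma> / 2 * (norm (\<xi> - z'))\<^sup>2
                   - \<delta> * rho_t \<sigma> \<rho> t / 2 * (norm (A z' - b))\<^sup>2))"

definition prim_argmin ::
  "(real^'n \<Rightarrow> ereal) \<Rightarrow> (real^'n \<Rightarrow> real^'m) \<Rightarrow> real^'m \<Rightarrow> real \<Rightarrow> real \<Rightarrow> real \<Rightarrow> real^'n^'n \<Rightarrow>
   real^'n \<Rightarrow> real^'m \<Rightarrow> (real^'n) set" where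
  "prim_argmin \<Psi> A b \<sigma> \<rho> t M z y =
     {z'. is_arg_min
            (\<lambda>\<xi>. \<Psi> \<xi> + ereal (y \<bullet> (A \<xi> - b) + rho_t \<sigma> \<rho> t * ((A z - b) \<bullet> A \<xi>)
                             + tau_t \<sigma> t / 2 * (mnorm M (\<xi> - z))\<^sup>2))
            (\<lambda>_. True) z'}"

end

theory Submission
  imports Defs
begin

text \<open>The proof rests on two facts.

  The subproblem objective is \<open>\<Psi> + q\<close>, where \<open>q\<close> is affine plus \<open>\<tau>/2 \<parallel>\<cdot> - z\<parallel>\<^sub>M\<^sup>2\<close>. Its quadratic part
  satisfies the strong convexity inequality in the \<open>M\<close>-norm with equality, so the strong convexity of
  \<open>\<Psi> + q\<close> is measured by \<open>\<sigma>/2 \<parallel>\<cdot>\<parallel>\<^sup>2 + \<tau>/2 \<parallel>\<cdot>\<parallel>\<^sub>M\<^sup>2\<close>, and its values at any \<open>\<xi>\<close> exceed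
  the minimum by at least that quantity at \<open>\<xi> - z'\<close>. This growth estimate
  (\<open>strongly_convex_plus_minimizer_growth\<close>) is obtained by moving from \<open>z'\<close> towards \<open>\<xi>\<close>
  along a segment.

  The growth estimate is an inequality in the \<open>M\<close>-norm. Passing to \<open>P = M - \<rho> A\<^sup>T A\<close> subtracts
  \<open>\<rho> \<parallel>A u\<parallel>\<^sup>2\<close> from every \<open>\<parallel>u\<parallel>\<^sub>M\<^sup>2\<close>. If \<open>A \<xi> = b\<close>, with residuals \<open>r = A z - b\<close> and
  \<open>r' = A z' - b\<close>, the net contribution of these terms to
  \<open>\<tau> \<Delta>\<^sub>P(\<xi>, z, z') - \<tau>/2 \<parallel>z' - z\<parallel>\<^sub>P\<^sup>2\<close> is, by the identity
  \<open>\<parallel>r'\<parallel>\<^sup>2 + \<parallel>r' - r\<parallel>\<^sup>2 - \<parallel>r\<parallel>\<^sup>2 = 2 \<parallel>r'\<parallel>\<^sup>2 - 2 \<langle>r, r'\<rangle>\<close>, equal to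
  \<open>\<rho> \<tau> (\<parallel>r'\<parallel>\<^sup>2 - \<langle>r, r'\<rangle>)\<close>. Here \<open>\<rho> \<tau>\<close> is the penalty parameter \<open>\<rho>\<^sub>t\<close>. The inner product
  cancels the linearised penalty in the subproblem; of the remaining \<open>\<rho>\<^sub>t \<parallel>r'\<parallel>\<^sup>2\<close>, one half is the
  penalty of the augmented Lagrangian at \<open>z'\<close> and the other half is the last term of the niceness
  inequality, which is why \<open>\<delta> = 1\<close>.\<close>

lemma mnorm_square: "(mnorm P u)\<^sup>2 = u \<bullet> (P *v u)" if "psd P"
  using that by (simp add: mnorm_def psd_def)

lemma pos_definite_imp_psd: "psd M" if "pos_definite M"
proof -
  have "0 \<le> u \<bullet> (M *v u)" for u
    using that by (cases "u = 0") (auto simp: pos_definite_def less_imp_le)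
  then show ?thesis
    using that by (auto simp: psd_def pos_definite_def)
qed

lemma quadratic_form_minus_gram:
  fixes A :: "real^'n \<Rightarrow> real^'m"
  assumes "linear A"
  shows "u \<bullet> ((M - \<rho> *\<^sub>R (transpose (matrix A) ** matrix A)) *v u)
           = u \<bullet> (M *v u) - \<rho> * (norm (A u))\<^sup>2"
proof -
  have "u \<bullet> (transpose (matrix A) *v (matrix A *v u)) = (norm (A u))\<^sup>2"
    using dot_lmul_matrix[of "matrix A *v u" "matrix A" u] assms
    by (simp add: matrix_works power2_norm_eq_inner inner_commute)
  then show ?thesis
    by (simp add: matrix_vector_mult_diff_rdistrib scaleR_matrix_vector_assoc[symmetric]
        matrix_vector_mul_assoc[symmetric] inner_diff_right)
qed

text \<open>By bilinearity of \<open>(u, v) \<mapsto> u \<bullet> (M *v v)\<close>, on a segment a quadratic form differs from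
  its linear interpolation by exactly \<open>\<theta> (1 - \<theta>)\<close> times its value at the difference of the end points.\<close>
lemma quadratic_form_segment:
  fixes M :: "real^'n^'n"
  shows "(\<theta> *\<^sub>R u + (1 - \<theta>) *\<^sub>R v) \<bullet> (M *v (\<theta> *\<^sub>R u + (1 - \<theta>) *\<^sub>R v))
           = \<theta> * (u \<bullet> (M *v u)) + (1 - \<theta>) * (v \<bullet> (M *v v))
             - \<theta> * (1 - \<theta>) * ((u - v) \<bullet> (M *v (u - v)))"
  unfolding matrix_vector_right_distrib matrix_vector_mult_diff_distrib
      matrix_vector_mult_scaleR inner_add_left inner_add_right inner_diff_left inner_diff_right
      inner_scaleR_left inner_scaleR_right
  by algebra

text \<open>Compare the value at the minimizer \<open>w\<close> with the value at \<open>\<theta> x + (1 - \<theta>) w\<close>: after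
  cancelling the factor \<open>\<theta>\<close>, the gap at \<open>x\<close> is at least \<open>1 - \<theta>\<close> times the convexity modulus, and
  \<open>\<theta>\<close> tends to \<open>0\<close>. The modulus of \<open>q\<close> is an arbitrary function \<open>N\<close>, so that it may be measured
  in a norm different from that of \<open>f\<close>.\<close>
lemma strongly_convex_plus_minimizer_growth:
  fixes f :: "'a::real_normed_vector \<Rightarrow> ereal" and q N :: "'a \<Rightarrow> real"
  assumes f: "strongly_convex \<sigma> f"
    and q: "\<And>\<theta> x y. q (\<theta> *\<^sub>R x + (1 - \<theta>) *\<^sub>R y)
                \<le> \<theta> * q x + (1 - \<theta>) * q y - \<theta> * (1 - \<theta>) * N (x - y)"
    and min: "\<And>y. f w + ereal (q w) \<le> f y + ereal (q y)"
    and fw: "f w = ereal c" and fx: "f x = ereal d"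
  shows "c + q w + \<sigma> / 2 * (norm (x - w))\<^sup>2 + N (x - w) \<le> d + q x"
proof -
  define D where "D = \<sigma> / 2 * (norm (x - w))\<^sup>2 + N (x - w)"
  have "s * D \<le> d + q x - (c + q w)" if s: "0 < s" "s < 1" for s
  proof -
    define \<theta> where "\<theta> = 1 - s"
    have \<theta>: "0 < \<theta>" "\<theta> < 1" using s by (auto simp: \<theta>_def)
    define p where "p = \<theta> *\<^sub>R x + (1 - \<theta>) *\<^sub>R w"
    define e where "e = \<theta> * d + (1 - \<theta>) * c - \<sigma> / 2 * \<theta> * (1 - \<theta>) * (norm (x - w))\<^sup>2"
    have "f p \<le> ereal \<theta> * f x + ereal (1 - \<theta>) * f w
            - ereal (\<sigma> / 2 * \<theta> * (1 - \<theta>) * (norm (x - w))\<^sup>2)"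
      using f \<theta> unfolding strongly_convex_def p_def by simp
    then have "f p \<le> ereal e"
      by (simp add: fw fx e_def)
    then have "f w + ereal (q w) \<le> ereal e + ereal (q p)"
      using min[of p] add_right_mono order_trans by blast
    then have "c + q w \<le> e + q p"
      by (simp add: fw)
    moreover have "q p \<le> \<theta> * q x + (1 - \<theta>) * q w - \<theta> * (1 - \<theta>) * N (x - w)"
      unfolding p_def by (rule q)
    ultimately have "\<theta> * (s * D) \<le> \<theta> * (d + q x - (c + q w))"
      by (simp add: e_def D_def \<theta>_def algebra_simps)
    then show ?thesis using \<theta> by simp
  qed
  then have "D \<le> d + q x - (c + q w)"
    by (rule field_le_mult_one_interval)
  then show ?thesis by (simp add: D_def)
qed

text \<open>The conversion from the \<open>M\<close>-norm to the \<open>P\<close>-norm; feasibility of \<open>\<xi>\<close> turns \<open>A (\<xi> - z)\<close> and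
  \<open>A (\<xi> - z')\<close> into negated residuals.\<close>
lemma three_point_minus_gram:
  fixes A :: "real^'n \<Rightarrow> real^'m" and M :: "real^'n^'n" and \<rho> :: real
  defines "P \<equiv> M - \<rho> *\<^sub>R (transpose (matrix A) ** matrix A)"
  assumes A: "linear A" and M: "psd M" and P: "psd P" and \<xi>: "A \<xi> = b"
  shows "mDelta P \<xi> z z' - 1 / 2 * (mnorm P (z' - z))\<^sup>2
           = mDelta M \<xi> z z' - 1 / 2 * (mnorm M (z' - z))\<^sup>2
             + \<rho> * ((norm (A z' - b))\<^sup>2 - (A z - b) \<bullet> (A z' - b))"
proof -
  have sq: "(mnorm P u)\<^sup>2 = (mnorm M u)\<^sup>2 - \<rho> * (norm (A u))\<^sup>2" for u
    using quadratic_form_minus_gram[OF A] mnorm_square[OF P] mnorm_square[OF M]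
    by (simp add: P_def)
  define r where "r = A z - b"
  define r' where "r' = A z' - b"
  have res: "A (\<xi> - z) = - r" "A (\<xi> - z') = - r'" "A (z' - z) = r' - r"
    using \<xi> by (simp_all add: linear_diff[OF A] r_def r'_def)
  have norm_diff: "(norm (r' - r))\<^sup>2 = (norm r')\<^sup>2 + (norm r)\<^sup>2 - 2 * (r \<bullet> r')"
    by (simp add: power2_norm_eq_inner inner_diff_left inner_diff_right inner_commute)
  show ?thesis
    unfolding mDelta_def sq res norm_minus_cancel norm_diff r_def[symmetric] r'_def[symmetric]
    by argo
qed

theorem lemma5p3:
  fixes \<Psi> :: "real^'n \<Rightarrow> ereal"
    and A :: "real^'n \<Rightarrow> real^'m"
    and b :: "real^'m"
    and \<sigma> \<rho> t :: real
    and M :: "real^'n^'n"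
  assumes "proper_fun \<Psi>" and "lower_semicontinuous \<Psi>"
    and "\<sigma> \<ge> 0" and "strongly_convex \<sigma> \<Psi>"
    and "linear A"
    and "\<exists>xs ys. saddle_point (lagr \<Psi> A b) xs ys"
    and "\<rho> > 0" and "t > 0"
    and "pos_definite M"
    and "psd (M - \<rho> *\<^sub>R (transpose (matrix A) ** matrix A))"
  shows "nice_primal_map \<Psi> A b \<sigma> \<rho> t (prim_argmin \<Psi> A b \<sigma> \<rho> t M) 1
           (M - \<rho> *\<^sub>R (transpose (matrix A) ** matrix A))
           (M - \<rho> *\<^sub>R (transpose (matrix A) ** matrix A))"
proof -
  define P where "P = M - \<rho> *\<^sub>R (transpose (matrix A) ** matrix A)"
  define \<tau> where "\<tau> = tau_t \<sigma> t"
  have rho_eq: "rho_t \<sigma> \<rho> t = \<rho> * \<tau>"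
    by (simp add: rho_t_def tau_t_def \<tau>_def)
  have P: "psd P" and M: "psd M"
    using assms pos_definite_imp_psd by (auto simp: P_def)
  have nice: "aug_lagr \<Psi> A b (rho_t \<sigma> \<rho> t) z' y - aug_lagr \<Psi> A b (rho_t \<sigma> \<rho> t) \<xi> y
          \<le> ereal (\<tau> * mDelta P \<xi> z z' - \<tau> / 2 * (mnorm P (z' - z))\<^sup>2
              - \<sigma> / 2 * (norm (\<xi> - z'))\<^sup>2 - 1 * rho_t \<sigma> \<rho> t / 2 * (norm (A z' - b))\<^sup>2)"
    if z': "z' \<in> prim_argmin \<Psi> A b \<sigma> \<rho> t M z y" and "\<xi> \<in> feasible A b" for z y z' \<xi>
  proof -
    have A\<xi>: "A \<xi> = b" using that by (simp add: feasible_def)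
    define q where "q = (\<lambda>x. y \<bullet> (A x - b) + \<rho> * \<tau> * ((A z - b) \<bullet> A x)
                               + \<tau> / 2 * (mnorm M (x - z))\<^sup>2)"
    have min: "\<Psi> z' + ereal (q z') \<le> \<Psi> v + ereal (q v)" for v
      using z' by (auto simp: prim_argmin_def is_arg_min_def q_def rho_eq \<tau>_def not_less)
    obtain x0 where "\<Psi> x0 \<noteq> \<infinity>" and not_minf: "\<And>x. \<Psi> x \<noteq> -\<infinity>"
      using assms(1) by (auto simp: proper_fun_def)
    then have "\<Psi> z' \<noteq> \<infinity>"
      using min[of x0] by auto
    then obtain c where c: "\<Psi> z' = ereal c"
      using not_minf[of z'] by (cases "\<Psi> z'") auto
    show ?thesis
    proof (cases "\<Psi> \<xi>")
      case PInf
      \<comment> \<open>Finiteness of \<open>\<Psi> z'\<close> makes the left-hand side \<open>-\<infinity>\<close>.\<close>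
      then show ?thesis by (simp add: aug_lagr_def lagr_def c)
    next
      case MInf
      then show ?thesis using not_minf[of \<xi>] by simp
    next
      case (real d)
      have q_segment: "q (\<theta> *\<^sub>R u + (1 - \<theta>) *\<^sub>R v)
          \<le> \<theta> * q u + (1 - \<theta>) * q v - \<theta> * (1 - \<theta>) * (\<tau> / 2 * (mnorm M (u - v))\<^sup>2)" for \<theta> u v
      proof -
        have shift: "\<theta> *\<^sub>R u + (1 - \<theta>) *\<^sub>R v - z = \<theta> *\<^sub>R (u - z) + (1 - \<theta>) *\<^sub>R (v - z)"
          by (simp add: algebra_simps)
        have M_seg: "(mnorm M (\<theta> *\<^sub>R u + (1 - \<theta>) *\<^sub>R v - z))\<^sup>2
            = \<theta> * (mnorm M (u - z))\<^sup>2 + (1 - \<theta>) * (mnorm M (v - z))\<^sup>2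
              - \<theta> * (1 - \<theta>) * (mnorm M (u - v))\<^sup>2"
          using quadratic_form_segment[of \<theta> "u - z" "v - z" M]
          unfolding mnorm_square[OF M] shift by simp
        have A_seg: "A (\<theta> *\<^sub>R u + (1 - \<theta>) *\<^sub>R v) = \<theta> *\<^sub>R A u + (1 - \<theta>) *\<^sub>R A v"
          using assms(5) by (simp add: linear_add linear_scale)
        show ?thesis
          unfolding q_def M_seg A_seg inner_add_right inner_diff_right inner_scaleR_right
          by argo
      qed
      have growth: "c + q z' + \<sigma> / 2 * (norm (\<xi> - z'))\<^sup>2 + \<tau> / 2 * (mnorm M (\<xi> - z'))\<^sup>2 \<le> d + q \<xi>"
        by (rule strongly_convex_plus_minimizer_growth
            [where N = "\<lambda>v. \<tau> / 2 * (mnorm M v)\<^sup>2", OF assms(4) q_segment min c real])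
      define r where "r = A z - b"
      define r' where "r' = A z' - b"
      have "r \<bullet> b = r \<bullet> A z' - r \<bullet> r'"
        by (simp add: r'_def inner_diff_right)
      then have q_diff: "q \<xi> - q z' = - (y \<bullet> r') - \<rho> * \<tau> * (r \<bullet> r')
          + \<tau> / 2 * (mnorm M (\<xi> - z))\<^sup>2 - \<tau> / 2 * (mnorm M (z' - z))\<^sup>2"
        unfolding q_def r_def[symmetric] r'_def[symmetric] A\<xi>
        by (simp add: right_diff_distrib)
      have conv: "\<tau> * mDelta P \<xi> z z' - \<tau> / 2 * (mnorm P (z' - z))\<^sup>2
          = \<tau> / 2 * (mnorm M (\<xi> - z))\<^sup>2 - \<tau> / 2 * (mnorm M (\<xi> - z'))\<^sup>2
            - \<tau> / 2 * (mnorm M (z' - z))\<^sup>2 + \<rho> * \<tau> * (norm r')\<^sup>2 - \<rho> * \<tau> * (r \<bullet> r')"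
        using arg_cong[OF three_point_minus_gram[OF assms(5) M P[unfolded P_def] A\<xi>, of z z'],
            of "\<lambda>v. \<tau> * v"]
        unfolding P_def[symmetric] r_def[symmetric] r'_def[symmetric] mDelta_def[of M]
        by (simp add: algebra_simps)
      have "c + y \<bullet> r' + \<rho> * \<tau> / 2 * (norm r')\<^sup>2 - d
          \<le> \<tau> * mDelta P \<xi> z z' - \<tau> / 2 * (mnorm P (z' - z))\<^sup>2
            - \<sigma> / 2 * (norm (\<xi> - z'))\<^sup>2 - \<rho> * \<tau> / 2 * (norm r')\<^sup>2"
        using growth q_diff conv by (simp add: field_simps)
      then show ?thesis
        by (simp add: aug_lagr_def lagr_def c real A\<xi> rho_eq r'_def)
    qed
  qed
  have "(1::real) \<in> {0<..1}" by simp
  then show ?thesis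
    unfolding nice_primal_map_def \<tau>_def[symmetric] P_def[symmetric]
    by (intro conjI allI ballI P nice)
qed

end
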